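(* For all integers $n\ge 3$ and $m\ge 2$, $\chi_{la}(T(m,n))=3$.
   Context: A local antimagic labeling of a connected graph $G=(V,E)$ is a bijection $f:E\to\{1,\dots,|E|\}$ such that, with $f^+(u)=\sum f(e)$ (sum over all edges $e$ incident to $u$), one has $f^+(u)\neq f^+(v)$ for every pair of adjacent vertices $u,v$. The color number $c(f)$ is the number of distinct values of $f^+$ on $V$. The local antimagic chromatic number $\chi_{la}(G)$ is the minimum of $c(f)$ over all local antimagic labelings $f$ of $G$. The tadpole graph $T(m,n)$ is obtained from a path $P_m$ on $m$ vertices and a cycle $C_n$ on $n$ vertices by identifying an end vertex of $P_m$ with a vertex of $C_n$; it has $m+n-1$ vertices and $m+n-1$ edges. *)

theory Defs
  imports Main
begin

text \<open>
  A graph is a pair of a vertex set and a set of edges, each edge being the set of its two ends.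
\<close>

type_synonym 'a graph = "'a set \<times> 'a set set"

abbreviation verts :: "'a graph \<Rightarrow> 'a set" where "verts \<equiv> fst"
abbreviation edges :: "'a graph \<Rightarrow> 'a set set" where "edges \<equiv> snd"

definition simple_graph :: "'a graph \<Rightarrow> bool" where
  "simple_graph G \<longleftrightarrow>
     finite (verts G) \<and> (\<forall>e \<in> edges G. e \<subseteq> verts G \<and> card e = 2)"

definition connected_graph :: "'a graph \<Rightarrow> bool" where
  "connected_graph G \<longleftrightarrow>
     simple_graph G \<and> verts G \<noteq> {} \<and>
     (\<forall>u \<in> verts G. \<forall>v \<in> verts G. (u, v) \<in> {(x, y). {x, y} \<in> edges G}\<^sup>*)"

definition vertex_sum :: "'a graph \<Rightarrow> ('a set \<Rightarrow> nat) \<Rightarrow> 'a \<Rightarrow> nat" where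
  "vertex_sum G f u = (\<Sum>e \<in> {e \<in> edges G. u \<in> e}. f e)"

definition local_antimagic_labeling :: "'a graph \<Rightarrow> ('a set \<Rightarrow> nat) \<Rightarrow> bool" where
  "local_antimagic_labeling G f \<longleftrightarrow>
     connected_graph G \<and>
     bij_betw f (edges G) {1..card (edges G)} \<and>
     (\<forall>u v. {u, v} \<in> edges G \<longrightarrow> vertex_sum G f u \<noteq> vertex_sum G f v)"

definition color_number :: "'a graph \<Rightarrow> ('a set \<Rightarrow> nat) \<Rightarrow> nat" where
  "color_number G f = card (vertex_sum G f ` verts G)"

text \<open>
  The infimum of a nonempty set of naturals is its minimum.  If \<open>G\<close> has no local antimagic
  labeling, the value is the junk value 0; as a connected graph has a vertex, every color
  number is positive, so a positive value also asserts that a labeling exists.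
\<close>

definition local_antimagic_chromatic_number :: "'a graph \<Rightarrow> nat" where
  "local_antimagic_chromatic_number G =
     Inf {color_number G f | f. local_antimagic_labeling G f}"

definition path_graph :: "nat \<Rightarrow> nat graph" where
  "path_graph m = ({..<m}, {{i, i + 1} | i. i + 1 < m})"

definition cycle_graph :: "nat \<Rightarrow> nat graph" where
  "cycle_graph n = ({..<n}, {{i, (i + 1) mod n} | i. i < n})"

definition map_graph :: "('a \<Rightarrow> 'b) \<Rightarrow> 'a graph \<Rightarrow> 'b graph" where
  "map_graph h G = (h ` verts G, (\<lambda>e. h ` e) ` edges G)"

definition disjoint_union_graph :: "'a graph \<Rightarrow> 'b graph \<Rightarrow> ('a + 'b) graph" where
  "disjoint_union_graph G H =
     (verts (map_graph Inl G) \<union> verts (map_graph Inr H),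
      edges (map_graph Inl G) \<union> edges (map_graph Inr H))"

text \<open>The vertex \<open>a\<close> is merged into \<open>b\<close>, and every edge at \<open>a\<close> is redirected to \<open>b\<close>.\<close>

definition identify_vertices :: "'a \<Rightarrow> 'a \<Rightarrow> 'a graph \<Rightarrow> 'a graph" where
  "identify_vertices a b = map_graph (\<lambda>x. if x = a then b else x)"

definition tadpole_graph :: "nat \<Rightarrow> nat \<Rightarrow> (nat + nat) graph" where
  "tadpole_graph m n =
     identify_vertices (Inl 0) (Inr 0) (disjoint_union_graph (path_graph m) (cycle_graph n))"

end

theory Submission
  imports Defs
begin

text \<open>
  Lower bound: if only two colors occur, they split the vertices into classes \<open>A\<close> and \<open>B\<close>, and
  every edge joins the classes, so both classes have total color \<open>1 + \<dots> + N\<close>, where \<open>N\<close> is the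
  number of edges.  If \<open>A\<close> contains the pendant vertex, its color is a label, hence at most \<open>N\<close>; as
  the edge labelled \<open>N\<close> meets \<open>A\<close>, the color is \<open>N\<close>.  So \<open>2 \<cdot> |A| = N + 1\<close>, and since there are as
  many vertices as edges, \<open>2 \<cdot> |B| = N - 1\<close>.  Thus \<open>N - 1\<close> divides \<open>N (N + 1)\<close>, whence \<open>N \<le> 3\<close>.

  Upper bound: walk from the pendant vertex along the tail and once around the cycle, and
  label the edges \<open>N, 1, N - 1, 2, \<dots>\<close> in this order.  Consecutive labels add up alternately to
  \<open>N + 1\<close> and \<open>N\<close>, the pendant vertex has color \<open>N\<close>, and the junction gets a larger color.
\<close>

section \<open>Lower bound for graphs with a pendant vertex\<close>

text \<open>Double counting: after the sums are swapped, each label is counted once for every end of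
  its edge in \<open>A\<close>, hence exactly once.\<close>

lemma sum_vertex_sum_transversal:
  assumes "finite A" "finite (edges G)"
    and "\<And>e. e \<in> edges G \<Longrightarrow> card (e \<inter> A) = 1"
  shows "(\<Sum>v\<in>A. vertex_sum G f v) = (\<Sum>e\<in>edges G. f e)"
proof -
  have "(\<Sum>v\<in>A. vertex_sum G f v) = (\<Sum>v\<in>A. \<Sum>e\<in>{e \<in> edges G. v \<in> e}. f e)"
    by (simp add: vertex_sum_def)
  also have "\<dots> = (\<Sum>e\<in>edges G. \<Sum>v\<in>{v \<in> A. v \<in> e}. f e)"
    by (rule sum.swap_restrict[OF assms(1,2)])
  also have "\<dots> = (\<Sum>e\<in>edges G. f e)"
  proof (rule sum.cong[OF refl])
    fix e assume "e \<in> edges G"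
    moreover have "{v \<in> A. v \<in> e} = e \<inter> A" by auto
    ultimately show "(\<Sum>v\<in>{v \<in> A. v \<in> e}. f e) = f e"
      using assms(3) by simp
  qed
  finally show ?thesis .
qed

lemma sum_labels:
  assumes "bij_betw f (edges G) {1..card (edges G)}"
  shows "2 * (\<Sum>e\<in>edges G. f e) = card (edges G) * Suc (card (edges G))"
proof -
  have "(\<Sum>e\<in>edges G. f e) = \<Sum> {1..card (edges G)}"
    using sum.reindex_bij_betw[OF assms, of "\<lambda>x. x"] by simp
  also have "\<dots> = \<Sum> {0..card (edges G)}"
    by (simp add: sum.atLeast_Suc_atMost)
  finally show ?thesis using gauss_sum_nat[of "card (edges G)"] by simp
qed

text \<open>Only the pendant vertex and the equal numbers of vertices and edges enter the count, so
  the argument is carried out for a general \<open>G\<close>. The bound 4 excludes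
  \<open>N = 3\<close>, where the final divisibility gives no contradiction.\<close>

lemma color_number_ge_3:
  assumes lab: "local_antimagic_labeling G f"
    and pendant: "v \<in> verts G" "{e \<in> edges G. v \<in> e} = {p}"
    and card: "card (verts G) = card (edges G)" "4 \<le> card (edges G)"
  shows "3 \<le> color_number G f"
proof (rule ccontr)
  assume "\<not> 3 \<le> color_number G f"
  define N where "N = card (edges G)"
  have bij: "bij_betw f (edges G) {1..N}"
    and proper: "\<And>x y. {x, y} \<in> edges G \<Longrightarrow> vertex_sum G f x \<noteq> vertex_sum G f y"
    and simple: "simple_graph G"
    using lab by (auto simp: local_antimagic_labeling_def connected_graph_def N_def)
  have finV: "finite (verts G)" using simple by (simp add: simple_graph_def)
  have finE: "finite (edges G)" using card(2) by (intro card_ge_0_finite) simp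
  have edgeE: "\<exists>x y. e = {x, y} \<and> x \<in> verts G \<and> y \<in> verts G \<and> x \<noteq> y" if "e \<in> edges G" for e
  proof -
    have "card e = 2" "e \<subseteq> verts G" using simple that by (auto simp: simple_graph_def)
    then show ?thesis by (auto simp: card_2_iff)
  qed
  have p: "p \<in> edges G" "v \<in> p" using pendant(2) by blast+
  obtain u where u: "u \<in> verts G" "{v, u} \<in> edges G"
    using edgeE[OF p(1)] p by (auto simp: insert_commute)
  define a b where "a = vertex_sum G f v" and "b = vertex_sum G f u"
  have ab: "a \<noteq> b" using proper[OF u(2)] by (simp add: a_def b_def)
  have sub: "{a, b} \<subseteq> vertex_sum G f ` verts G" using pendant(1) u by (auto simp: a_def b_def)
  have colors: "vertex_sum G f ` verts G = {a, b}"
  proof (rule card_seteq[symmetric])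
    show "card (vertex_sum G f ` verts G) \<le> card {a, b}"
      using \<open>\<not> 3 \<le> color_number G f\<close> ab by (simp add: color_number_def)
  qed (use sub finV in auto)
  define A B where "A = {x \<in> verts G. vertex_sum G f x = a}"
    and "B = {x \<in> verts G. vertex_sum G f x = b}"
  have fin: "finite A" "finite B" using finV by (auto simp: A_def B_def)
  have part: "verts G = A \<union> B" "A \<inter> B = {}" using colors ab by (auto simp: A_def B_def)
  have ends: "card (e \<inter> A) = 1 \<and> card (e \<inter> B) = 1" if e: "e \<in> edges G" for e
  proof -
    obtain x y where xy: "e = {x, y}" "x \<in> verts G" "y \<in> verts G" using edgeE[OF e] by blast
    have "vertex_sum G f x \<noteq> vertex_sum G f y" using proper xy e by blast
    then have "\<not> (x \<in> A \<and> y \<in> A)" "\<not> (x \<in> B \<and> y \<in> B)"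
      by (simp_all add: A_def B_def)
    moreover have "x \<in> A \<or> x \<in> B" "y \<in> A \<or> y \<in> B"
      using xy(2,3) by (simp_all add: part(1))
    ultimately consider "x \<in> A" "x \<notin> B" "y \<in> B" "y \<notin> A" | "y \<in> A" "y \<notin> B" "x \<in> B" "x \<notin> A"
      using part(2) by blast
    then show ?thesis by cases (simp_all add: xy(1))
  qed
  have a_le: "a \<le> N"
    using bij_betwE[OF bij] p pendant(2) by (simp add: a_def vertex_sum_def)
  moreover have "N \<le> a"
  proof -
    have "N \<in> {1..N}" using card by (simp add: N_def)
    then obtain e where e: "e \<in> edges G" "f e = N"
      using bij_betw_imp_surj_on[OF bij] by (metis imageE)
    then have "e \<inter> A \<noteq> {}" using ends by fastforce
    then obtain x where x: "x \<in> e" "x \<in> A" by blast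
    have "f e \<le> vertex_sum G f x"
      unfolding vertex_sum_def using e x finE by (intro member_le_sum) auto
    with e x show ?thesis by (simp add: A_def)
  qed
  ultimately have a: "a = N" by simp
  have total: "2 * (\<Sum>e\<in>edges G. f e) = N * Suc N"
    using sum_labels[of f G] bij by (simp add: N_def)
  have "(\<Sum>x\<in>A. vertex_sum G f x) = card A * a" "(\<Sum>x\<in>B. vertex_sum G f x) = card B * b"
    by (simp_all add: A_def B_def)
  then have A: "2 * (card A * a) = N * Suc N" and B: "2 * (card B * b) = N * Suc N"
    using sum_vertex_sum_transversal[OF fin(1) finE, of f] sum_vertex_sum_transversal[OF fin(2) finE, of f]
      ends total by auto
  have AB: "card A + card B = N"
    using card_Un_disjoint[OF fin part(2)] part(1) card(1) by (simp add: N_def)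
  have "4 \<le> N" using card by (simp add: N_def)
  have "N * (2 * card A) = N * Suc N" using A by (simp add: a mult_ac)
  then have A: "2 * card A = Suc N" using \<open>4 \<le> N\<close> by (subst (asm) mult_cancel1) simp
  \<comment> \<open>As \<open>card A\<close> is half of \<open>N + 1\<close>, the other class has
    half of \<open>N - 1\<close> vertices; writing \<open>N\<close> in terms of \<open>r\<close>
    avoids subtraction and division.\<close>
  define r where "r = card B"
  have N: "N = 2 * r + 1" using A AB by (simp add: r_def)
  have r: "2 \<le> r" using \<open>4 \<le> N\<close> N by simp
  have "2 * (r * b) = (2 * r + 1) * (2 * r + 2)" using B by (simp add: N r_def[symmetric])
  \<comment> \<open>Half of the right side is \<open>(2 * r + 1) * (r + 1)\<close>, which leaves
    remainder 1 modulo \<open>r\<close>.\<close>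
  then have "r * b = r * (2 * r + 3) + 1" by (simp add: algebra_simps)
  then have "r dvd 1" by (metis dvd_add_right_iff dvd_triv_left)
  with r show False by simp
qed

section \<open>The tadpole as a walk\<close>

text \<open>
  Numbering of the vertices along the walk: \<open>0\<close> is the pendant vertex, \<open>k\<close> the junction.
\<close>

definition walk_vertex :: "nat \<Rightarrow> nat \<Rightarrow> nat + nat" where
  "walk_vertex k t = (if t < k then Inl (k - t) else Inr (t - k))"

text \<open>The last vertex \<open>k + n - 1\<close> leads back to the junction \<open>k\<close>,
  not to \<open>0\<close>; this closes the cycle and leaves the tail open.\<close>

definition walk_next :: "nat \<Rightarrow> nat \<Rightarrow> nat \<Rightarrow> nat" where
  "walk_next k n t = (if Suc t = k + n then k else Suc t)"

definition walk_edge :: "nat \<Rightarrow> nat \<Rightarrow> nat \<Rightarrow> (nat + nat) set" where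
  "walk_edge k n t = {walk_vertex k t, walk_vertex k (walk_next k n t)}"

lemma inj_walk_vertex: "inj (walk_vertex k)"
  by (auto simp: inj_def walk_vertex_def split: if_splits)

lemma walk_next_less: "t < k + n \<Longrightarrow> 0 < n \<Longrightarrow> walk_next k n t < k + n"
  by (auto simp: walk_next_def)

lemma walk_vertex_in_walk_edge:
  "walk_vertex k s \<in> walk_edge k n t \<longleftrightarrow> s = t \<or> s = walk_next k n t"
  by (simp add: walk_edge_def inj_eq[OF inj_walk_vertex])

text \<open>If two different indices gave the same edge, each would be the successor of the other,
  which a cycle of length at least 3 rules out.\<close>

lemma inj_on_walk_edge:
  assumes "3 \<le> n"
  shows "inj_on (walk_edge k n) {..<k + n}"
proof (rule inj_onI)
  fix s t assume st: "s \<in> {..<k + n}" "t \<in> {..<k + n}" "walk_edge k n s = walk_edge k n t"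
  then have "s = t \<or> s = walk_next k n t" "t = s \<or> t = walk_next k n s"
    using walk_vertex_in_walk_edge by metis+
  then show "s = t" using st assms by (auto simp: walk_next_def split: if_splits)
qed

text \<open>\<open>Inl 0\<close> is merged into \<open>Inr 0\<close>, the junction; the tail keeps
  \<open>Inl 1\<close> to \<open>Inl k\<close>, which the walk visits in decreasing order.\<close>

lemma verts_tadpole_graph:
  assumes "0 < n"
  shows "verts (tadpole_graph (Suc k) n) = walk_vertex k ` {..<k + n}"
proof -
  have "verts (tadpole_graph (Suc k) n) = Inl ` {1..k} \<union> Inr ` {..<n}"
    using assms
    by (auto simp: tadpole_graph_def identify_vertices_def map_graph_def disjoint_union_graph_def
        path_graph_def cycle_graph_def image_iff Bex_def)
  also have "{1..k} = (\<lambda>t. k - t) ` {..<k}"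
  proof -
    have "x \<in> (\<lambda>t. k - t) ` {..<k}" if "x \<in> {1..k}" for x
      using that by (intro image_eqI[of _ _ "k - x"]) auto
    then show ?thesis by auto
  qed
  also have "{..<n} = (\<lambda>t. t - k) ` {k..<k + n}"
  proof -
    have "x \<in> (\<lambda>t. t - k) ` {k..<k + n}" if "x \<in> {..<n}" for x
      using that by (intro image_eqI[of _ _ "k + x"]) auto
    then show ?thesis by auto
  qed
  also have "Inl ` (\<lambda>t. k - t) ` {..<k} \<union> Inr ` (\<lambda>t. t - k) ` {k..<k + n}
      = walk_vertex k ` ({..<k} \<union> {k..<k + n})"
    by (auto simp: image_Un image_image walk_vertex_def)
  also have "{..<k} \<union> {k..<k + n} = {..<k + n}" by auto
  finally show ?thesis .
qed

lemma edges_tadpole_graph: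
  assumes "0 < n"
  shows "edges (tadpole_graph (Suc k) n) = walk_edge k n ` {..<k + n}"
proof -
  let ?g = "\<lambda>x :: nat + nat. if x = Inl 0 then Inr 0 else x"
  have "edges (tadpole_graph (Suc k) n) =
      (\<lambda>i. {?g (Inl i), ?g (Inl (Suc i))}) ` {..<k} \<union> (\<lambda>i. {Inr i, Inr (Suc i mod n)}) ` {..<n}"
    by (simp add: tadpole_graph_def identify_vertices_def map_graph_def disjoint_union_graph_def
        path_graph_def cycle_graph_def setcompr_eq_image image_Un image_image lessThan_def
        del: if_image_distrib)
  also have "(\<lambda>i. {?g (Inl i), ?g (Inl (Suc i))}) ` {..<k} = walk_edge k n ` {..<k}"
  proof -
    \<comment> \<open>The walk runs against the numbering of the path: path edge \<open>i\<close> is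
      walk edge \<open>k - Suc i\<close>.\<close>
    have "x \<in> (\<lambda>i. k - Suc i) ` {..<k}" if "x \<in> {..<k}" for x
      using that by (intro image_eqI[of _ _ "k - Suc x"]) auto
    then have "{..<k} = (\<lambda>i. k - Suc i) ` {..<k}" by auto
    then have "walk_edge k n ` {..<k} = walk_edge k n ` (\<lambda>i. k - Suc i) ` {..<k}" by simp
    also have "\<dots> = (\<lambda>i. {?g (Inl i), ?g (Inl (Suc i))}) ` {..<k}"
      unfolding image_image using assms
      by (intro image_cong refl) (auto simp: walk_edge_def walk_vertex_def walk_next_def)
    finally show ?thesis by simp
  qed
  also have "(\<lambda>i. {Inr i, Inr (Suc i mod n)}) ` {..<n} = walk_edge k n ` {k..<k + n}"
  proof -
    have "{k..<k + n} = (\<lambda>i. k + i) ` {..<n}"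
      by (simp add: lessThan_atLeast0 add.commute)
    moreover have "{Inr i, Inr (Suc i mod n)} = walk_edge k n (k + i)" if "i < n" for i
      using that by (auto simp: walk_edge_def walk_vertex_def walk_next_def)
    ultimately show ?thesis by (auto simp: image_image)
  qed
  also have "walk_edge k n ` {..<k} \<union> walk_edge k n ` {k..<k + n} = walk_edge k n ` {..<k + n}"
    by (simp add: image_Un[symmetric] ivl_disj_un)
  finally show ?thesis .
qed

lemma connected_tadpole_graph:
  assumes "3 \<le> n"
  shows "connected_graph (tadpole_graph (Suc k) n)"
proof -
  let ?G = "tadpole_graph (Suc k) n"
  let ?R = "{(x, y). {x, y} \<in> edges ?G}"
  have n: "0 < n" using assms by simp
  have next_ne: "t \<noteq> walk_next k n t" for t using assms by (auto simp: walk_next_def)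
  have simple: "simple_graph ?G"
    unfolding simple_graph_def verts_tadpole_graph[OF n] edges_tadpole_graph[OF n]
    using walk_next_less[OF _ n] next_ne
    by (auto simp: walk_edge_def card_insert_if inj_eq[OF inj_walk_vertex])
  have step: "(walk_vertex k t, walk_vertex k (Suc t)) \<in> ?R" if "Suc t < k + n" for t
  proof -
    have "walk_edge k n t \<in> edges ?G" using that by (simp add: edges_tadpole_graph[OF n])
    then show ?thesis using that by (simp add: walk_edge_def walk_next_def)
  qed
  have from0: "(walk_vertex k 0, walk_vertex k t) \<in> ?R\<^sup>*" if "t < k + n" for t
    using that
  proof (induction t)
    case (Suc t)
    then show ?case using step[of t] by (meson Suc_lessD rtrancl.rtrancl_into_rtrancl)
  qed simp
  \<comment> \<open>Any two vertices are joined through walk vertex \<open>0\<close>: back along the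
    walk to it, then forward.\<close>
  have "sym (?R\<^sup>*)" by (intro sym_rtrancl) (auto simp: sym_def insert_commute)
  then have "(u, v) \<in> ?R\<^sup>*" if "u \<in> verts ?G" "v \<in> verts ?G" for u v
    using that from0 unfolding verts_tadpole_graph[OF n] by (auto intro: rtrancl_trans dest: symD)
  with simple n show ?thesis
    by (auto simp: connected_graph_def verts_tadpole_graph)
qed

text \<open>Reduces colors to sums over edge indices; injectivity of \<open>walk_edge\<close>
  ensures that no label is lost.\<close>

lemma vertex_sum_tadpole_graph:
  assumes "3 \<le> n"
  shows "vertex_sum (tadpole_graph (Suc k) n) f (walk_vertex k s)
    = (\<Sum>t | t < k + n \<and> (s = t \<or> s = walk_next k n t). f (walk_edge k n t))"
proof -
  have "{e \<in> edges (tadpole_graph (Suc k) n). walk_vertex k s \<in> e}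
      = walk_edge k n ` {t. t < k + n \<and> (s = t \<or> s = walk_next k n t)}"
    using assms walk_vertex_in_walk_edge by (auto simp: edges_tadpole_graph)
  moreover have "inj_on (walk_edge k n) {t. t < k + n \<and> (s = t \<or> s = walk_next k n t)}"
    by (rule inj_on_subset[OF inj_on_walk_edge[OF assms]]) auto
  ultimately show ?thesis by (simp add: vertex_sum_def sum.reindex)
qed

section \<open>The alternating labeling\<close>

definition zigzag :: "nat \<Rightarrow> nat \<Rightarrow> nat" where
  "zigzag N t = (if even t then N - t div 2 else Suc t div 2)"

text \<open>Even positions count down from \<open>N\<close>, odd ones count up from 1, and the two
  runs do not meet within \<open>N\<close> positions. Injectivity into a set of the same size
  suffices.\<close>

lemma bij_betw_zigzag: "bij_betw (zigzag N) {..<N} {1..N}"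
proof -
  have inj: "inj_on (zigzag N) {..<N}"
    by (auto simp: inj_on_def zigzag_def elim!: evenE oddE)
  moreover have "zigzag N ` {..<N} \<subseteq> {1..N}"
    by (auto simp: zigzag_def elim!: oddE)
  ultimately have "zigzag N ` {..<N} = {1..N}"
    by (intro card_subset_eq) (auto simp: card_image)
  with inj show ?thesis by (simp add: bij_betw_def)
qed

lemma zigzag_add_Suc:
  assumes "Suc t < N"
  shows "zigzag N t + zigzag N (Suc t) = (if even t then Suc N else N)"
  using assms by (auto simp: zigzag_def elim!: evenE oddE)

lemma tadpole_graph_labeling:
  assumes n: "3 \<le> n" and k: "1 \<le> k"
  obtains f where "local_antimagic_labeling (tadpole_graph (Suc k) n) f"
    and "color_number (tadpole_graph (Suc k) n) f \<le> 3"
proof -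
  let ?G = "tadpole_graph (Suc k) n"
  define N where "N = k + n"
  have n0: "0 < n" using n by simp
  define f where "f = zigzag N \<circ> inv_into {..<N} (walk_edge k n)"
  have inj: "inj_on (walk_edge k n) {..<N}" using inj_on_walk_edge[OF n] by (simp add: N_def)
  have f: "f (walk_edge k n t) = zigzag N t" if "t < N" for t
    using that by (simp add: f_def inv_into_f_f[OF inj])
  have edges: "edges ?G = walk_edge k n ` {..<N}" by (simp add: edges_tadpole_graph n0 N_def)
  have card: "card (edges ?G) = N" by (simp add: edges card_image inj)
  have "bij_betw f (edges ?G) {1..N}"
    unfolding f_def edges
    by (rule bij_betw_trans[OF bij_betw_inv_into[OF inj_on_imp_bij_betw[OF inj]] bij_betw_zigzag])
  have sum: "vertex_sum ?G f (walk_vertex k s)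
      = (\<Sum>t | t < N \<and> (s = t \<or> s = walk_next k n t). zigzag N t)" for s
    unfolding vertex_sum_tadpole_graph[OF n] by (rule sum.cong) (auto simp: N_def[symmetric] f)
  define c where "c = vertex_sum ?G f (walk_vertex k k)"
  \<comment> \<open>Away from the junction, vertex \<open>s\<close> meets the edges
    \<open>s - 1\<close> and \<open>s\<close>. The pendant vertex has only the label
    \<open>N\<close>, which agrees with the even case.\<close>
  have plain: "vertex_sum ?G f (walk_vertex k s) = (if even s then N else Suc N)"
    if s: "s < N" "s \<noteq> k" for s
  proof (cases s)
    case 0
    then have "{t. t < N \<and> (s = t \<or> s = walk_next k n t)} = {0}"
      using k s by (auto simp: walk_next_def N_def)
    then show ?thesis using 0 by (simp add: sum zigzag_def)
  next
    case (Suc r)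
    then have "{t. t < N \<and> (s = t \<or> s = walk_next k n t)} = {r, Suc r}"
      using k s by (auto simp: walk_next_def N_def)
    then show ?thesis using zigzag_add_Suc[of r N] Suc s by (simp add: sum)
  qed
  have c: "Suc N < c"
  proof -
    \<comment> \<open>The last tail edge, the first cycle edge and the edge that closes the
      cycle.\<close>
    have eq: "{t. t < N \<and> (k = t \<or> k = walk_next k n t)} = {k - 1, k, N - 1}"
      using k n by (auto simp: walk_next_def N_def)
    have "c = zigzag N (k - 1) + zigzag N k + zigzag N (N - 1)"
    proof -
      have "k - 1 \<noteq> k" "k - 1 \<noteq> N - 1" "k \<noteq> N - 1" using k n by (auto simp: N_def)
      then show ?thesis by (simp add: c_def sum eq)
    qed
    moreover have "N \<le> zigzag N (k - 1) + zigzag N k"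
      using zigzag_add_Suc[of "k - 1" N] k n by (auto simp: N_def split: if_splits)
    \<comment> \<open>Label 1 sits at position 1, and the closing edge comes later because
      \<open>N \<ge> 4\<close>; so its label lifts the sum above \<open>Suc N\<close>.\<close>
    moreover have "2 \<le> zigzag N (N - 1)"
      using k n by (auto simp: zigzag_def N_def elim!: evenE oddE)
    ultimately show ?thesis by simp
  qed
  have "vertex_sum ?G f (walk_vertex k t) \<noteq> vertex_sum ?G f (walk_vertex k (walk_next k n t))"
    if t: "t < N" for t
  \<comment> \<open>At the junction \<open>c\<close> exceeds both other colors; elsewhere the ends
    are consecutive, so their parities differ.\<close>
  proof (cases "t = k \<or> walk_next k n t = k")
    case True
    have "t \<noteq> walk_next k n t" using n by (auto simp: walk_next_def)
    moreover have "walk_next k n t < N" using t walk_next_less[OF _ n0] by (simp add: N_def)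
    ultimately show ?thesis using True c plain[of t] plain[of "walk_next k n t"] t
      by (auto simp: c_def split: if_splits)
  next
    case False
    then have "walk_next k n t = Suc t" "Suc t < N"
      using t by (auto simp: walk_next_def N_def split: if_splits)
    then show ?thesis using False t plain[of t] plain[of "Suc t"] by auto
  qed
  then have "vertex_sum ?G f u \<noteq> vertex_sum ?G f v" if "{u, v} \<in> edges ?G" for u v
    using that by (fastforce simp: edges walk_edge_def doubleton_eq_iff)
  with \<open>bij_betw f (edges ?G) {1..N}\<close> connected_tadpole_graph[OF n] card
  have "local_antimagic_labeling ?G f"
    by (simp add: local_antimagic_labeling_def)
  moreover have "color_number ?G f \<le> 3"
  proof -
    have "vertex_sum ?G f ` verts ?G \<subseteq> {N, Suc N, c}"
    proof -
      have "vertex_sum ?G f (walk_vertex k s) \<in> {N, Suc N, c}" if "s < N" for s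
        using plain[OF that] by (cases "s = k") (simp_all add: c_def)
      then show ?thesis by (auto simp: verts_tadpole_graph[OF n0] N_def[symmetric])
    qed
    then have "color_number ?G f \<le> card {N, Suc N, c}"
      unfolding color_number_def by (intro card_mono) auto
    also have "\<dots> \<le> 3" by (simp add: card_insert_if)
    finally show ?thesis .
  qed
  ultimately show ?thesis using that by blast
qed

section \<open>The chromatic number of the tadpole\<close>

lemma color_number_tadpole_graph_ge_3:
  assumes n: "3 \<le> n" and k: "1 \<le> k"
    and lab: "local_antimagic_labeling (tadpole_graph (Suc k) n) f"
  shows "3 \<le> color_number (tadpole_graph (Suc k) n) f"
proof (rule color_number_ge_3[OF lab])
  let ?G = "tadpole_graph (Suc k) n"
  have n0: "0 < n" using n by simp
  show "walk_vertex k 0 \<in> verts ?G" using n by (auto simp: verts_tadpole_graph)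
  have "{e \<in> edges ?G. walk_vertex k 0 \<in> e}
      = walk_edge k n ` {t. t < k + n \<and> walk_vertex k 0 \<in> walk_edge k n t}"
    by (auto simp: edges_tadpole_graph[OF n0])
  \<comment> \<open>The walk returns to \<open>k \<ge> 1\<close>, so no edge leads into
    \<open>0\<close>.\<close>
  also have "{t. t < k + n \<and> walk_vertex k 0 \<in> walk_edge k n t} = {0}"
    using n k by (auto simp: walk_vertex_in_walk_edge walk_next_def)
  finally show "{e \<in> edges ?G. walk_vertex k 0 \<in> e} = {walk_edge k n 0}" by simp
  have "card (edges ?G) = k + n"
    by (simp add: edges_tadpole_graph[OF n0] card_image inj_on_walk_edge[OF n])
  moreover have "card (verts ?G) = k + n"
    by (simp add: verts_tadpole_graph[OF n0] card_image inj_on_subset[OF inj_walk_vertex])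
  ultimately show "card (verts ?G) = card (edges ?G)" "4 \<le> card (edges ?G)"
    using n k by auto
qed

theorem theorem2p7:
  fixes m n :: nat
  assumes "n \<ge> 3" and "m \<ge> 2"
  shows "local_antimagic_chromatic_number (tadpole_graph m n) = 3"
proof -
  obtain k where k: "m = Suc k" "1 \<le> k" using assms(2) by (cases m) auto
  obtain f where f: "local_antimagic_labeling (tadpole_graph m n) f"
    "color_number (tadpole_graph m n) f \<le> 3"
    using tadpole_graph_labeling[OF assms(1) k(2)] k(1) by blast
  have ge: "3 \<le> color_number (tadpole_graph m n) g"
    if "local_antimagic_labeling (tadpole_graph m n) g" for g
    using color_number_tadpole_graph_ge_3[OF assms(1) k(2)] that k(1) by blast
  then have "color_number (tadpole_graph m n) f = 3" using f by (simp add: le_antisym)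
  then show ?thesis
    unfolding local_antimagic_chromatic_number_def
    by (intro cInf_eq_minimum) (use f ge in auto)
qed

end
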